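(* Let $p>1$, let $H=(V,E,W)$ be a connected hypergraph and let $L\subset V$ be a nonempty set of labeled vertices. If $u_1,u_2:V\to\mathbb{R}$ are two functions that satisfy $$L_H^p u_1(x_j)=0\quad\text{and}\quad L_H^p u_2(x_j)=0\quad\text{for all }x_j\in V\setminus L,$$ and $$u_1(x_j)\le u_2(x_j)\quad\text{for all }x_j\in L,$$ then $$u_1(x_j)\le u_2(x_j)\quad\text{for all }x_j\in V.$$
   Context: A hypergraph $H=(V,E,W)$ consists of a finite vertex set $V=\{x_i\}_{i=1}^n\subset\mathbb{R}^d$, a finite family of hyperedges $E=\{e_k\}_{k=1}^m$ (nonempty subsets of $V$) and positive weights $W=\{w_k\}_{k=1}^m$. It is connected if for any $x_i,x_j\in V$ there are hyperedges $e_{k_1},\dots,e_{k_l}\in E$ with $x_i\in e_{k_1}$, $x_j\in e_{k_l}$ and $e_{k_s}\cap e_{k_{s+1}}\neq\emptyset$ for $s=1,\dots,l-1$. For $u:V\to\mathbb{R}$ and $x_i\in V$, $$L_H^p u(x_i)=\sum_{k=1}^m w_k\chi_k(x_i)\Big|\max_{x_j\in e_k}u(x_j)+\min_{x_j\in e_k}u(x_j)-2u(x_i)\Big|^{p-2}\Big(\max_{x_j\in e_k}u(x_j)+\min_{x_j\in e_k}u(x_j)-2u(x_i)\Big),$$ where $\chi_k(x_i)=1$ if $x_i\in e_k$ and $\chi_k(x_i)=0$ otherwise, with the convention $|0|^{p-2}0=0$ (also for $1<p<2$). *)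

theory Defs
  imports "HOL-Analysis.Analysis"
begin

text \<open>The hyperedges \<open>e\<^sub>1, \<dots>, e\<^sub>m\<close> and their weights form families indexed by \<open>{1..m}\<close>,
  so the same vertex set may occur several times as a hyperedge. The values of \<open>hedge\<close> and
  \<open>weight\<close> outside \<open>{1..m}\<close> are irrelevant.\<close>

record 'v hypergraph =
  verts :: "'v set"
  num_edges :: nat
  hedge :: "nat \<Rightarrow> 'v set"
  weight :: "nat \<Rightarrow> real"

definition is_hypergraph :: "'v hypergraph \<Rightarrow> bool" where
  "is_hypergraph H \<longleftrightarrow>
     finite (verts H) \<and>
     (\<forall>k\<in>{1..num_edges H}. hedge H k \<noteq> {} \<and> hedge H k \<subseteq> verts H \<and> weight H k > 0)"

text \<open>A connecting chain has at least one hyperedge, also when \<open>x = y\<close>. So every vertex of a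
  connected hypergraph lies in some hyperedge.\<close>

definition hypergraph_connected :: "'v hypergraph \<Rightarrow> bool" where
  "hypergraph_connected H \<longleftrightarrow>
     (\<forall>x\<in>verts H. \<forall>y\<in>verts H. \<exists>l\<ge>1. \<exists>\<kappa>::nat \<Rightarrow> nat.
        (\<forall>s\<in>{1..l}. \<kappa> s \<in> {1..num_edges H}) \<and>
        x \<in> hedge H (\<kappa> 1) \<and> y \<in> hedge H (\<kappa> l) \<and>
        (\<forall>s\<in>{1..<l}. hedge H (\<kappa> s) \<inter> hedge H (\<kappa> (s + 1)) \<noteq> {}))"

text \<open>Since \<open>0 powr a = 0\<close> for every \<open>a\<close>, a summand whose bracket vanishes is \<open>0\<close>, also for
  \<open>1 < p < 2\<close>. A function on the vertex set is represented by a total function; for a hypergraph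
  and a vertex \<open>x\<close>, only its values on the vertices enter.\<close>

definition hyper_L :: "'v hypergraph \<Rightarrow> real \<Rightarrow> ('v \<Rightarrow> real) \<Rightarrow> 'v \<Rightarrow> real" where
  "hyper_L H p u x =
     (\<Sum>k=1..num_edges H. weight H k * indicator (hedge H k) x *
        \<bar>Max (u ` hedge H k) + Min (u ` hedge H k) - 2 * u x\<bar> powr (p - 2) *
        (Max (u ` hedge H k) + Min (u ` hedge H k) - 2 * u x))"

end

theory Submission
  imports Defs
begin

text \<open>The proof is a maximum principle for \<open>u\<^sub>1 - u\<^sub>2\<close>. Suppose \<open>M = max (u\<^sub>1 - u\<^sub>2) > 0\<close> and let \<open>A\<close>
  be the set where this maximum is attained, so that \<open>A\<close> does not meet \<open>L\<close>. At \<open>x \<in> A\<close> both the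
  maximum and the minimum of \<open>u\<^sub>1\<close> over an edge exceed those of \<open>u\<^sub>2\<close> by at most \<open>M\<close>, whereas
  \<open>u\<^sub>1 x\<close> exceeds \<open>u\<^sub>2 x\<close> by exactly \<open>M\<close>. Hence every bracket in \<open>L\<^sub>H\<^sup>p u\<^sub>1 x\<close> is at most the
  corresponding one in \<open>L\<^sub>H\<^sup>p u\<^sub>2 x\<close>. As \<open>t \<mapsto> \<bar>t\<bar>\<^sup>p\<^sup>-\<^sup>2 t\<close> is strictly increasing and both
  operators vanish, the brackets agree (\<open>hyper_L_eq_imp_bracket_eq\<close>), so the edge maxima and the
  edge minima differ by exactly \<open>M\<close> (\<open>edge_extrema_at_contact\<close>).

  Directly, this only places some extremal vertices of each edge in \<open>A\<close>, not the whole edge. What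
  spreads along edges is the set \<open>S \<subseteq> A\<close> of vertices at which \<open>u\<^sub>1\<close> is largest within \<open>A\<close>. For
  \<open>x \<in> S\<close> the maximum of \<open>u\<^sub>1\<close> over any edge through \<open>x\<close> is attained in \<open>A\<close> and is therefore
  \<open>u\<^sub>1 x\<close>. All brackets of \<open>u\<^sub>1\<close> at \<open>x\<close> are then nonpositive and, as their weighted images under
  \<open>t \<mapsto> \<bar>t\<bar>\<^sup>p\<^sup>-\<^sup>2 t\<close> sum to \<open>0\<close>, all vanish, so that \<open>u\<^sub>1\<close> is constant on the edge. The extrema of
  \<open>u\<^sub>2\<close> differ from those of \<open>u\<^sub>1\<close> by \<open>M\<close>, so \<open>u\<^sub>2\<close> is constant as well and the edge lies in \<open>S\<close>
  (\<open>constant_on_edges_at_highest_contact\<close>). By connectedness \<open>S\<close> is the whole vertex set, which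
  contradicts \<open>S \<inter> L = {}\<close> and \<open>L \<noteq> {}\<close>.\<close>

lemma strict_mono_abs_powr_mult:
  fixes p :: real
  assumes "p > 1"
  shows "strict_mono (\<lambda>t::real. \<bar>t\<bar> powr (p - 2) * t)"
proof (rule strict_monoI)
  have pos: "\<bar>t\<bar> powr (p - 2) * t = t powr (p - 1)" if "t > 0" for t :: real
    using that powr_mult_base[of t "p - 2"] by (simp add: mult.commute)
  have neg: "\<bar>t\<bar> powr (p - 2) * t = - ((- t) powr (p - 1))" if "t < 0" for t :: real
    using pos[of "- t"] that by simp
  fix s t :: real
  assume "s < t"
  then consider "0 < s" | "s \<le> 0" "0 \<le> t" | "t < 0" by linarith
  then show "\<bar>s\<bar> powr (p - 2) * s < \<bar>t\<bar> powr (p - 2) * t"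
  proof cases
    case 1
    then show ?thesis
      using \<open>s < t\<close> assms pos[of s] pos[of t] powr_less_mono2[of "p - 1" s t] by simp
  next
    case 2
    then have "\<bar>s\<bar> powr (p - 2) * s \<le> 0" "0 \<le> \<bar>t\<bar> powr (p - 2) * t"
      by (simp_all add: mult_nonneg_nonpos)
    moreover have "\<bar>s\<bar> powr (p - 2) * s \<noteq> 0 \<or> \<bar>t\<bar> powr (p - 2) * t \<noteq> 0"
      using \<open>s < t\<close> by auto
    ultimately show ?thesis by linarith
  next
    case 3
    then show ?thesis
      using \<open>s < t\<close> assms neg[of s] neg[of t] powr_less_mono2[of "p - 1" "- t" "- s"] by simp
  qed
qed

definition bracket :: "'v hypergraph \<Rightarrow> ('v \<Rightarrow> real) \<Rightarrow> 'v \<Rightarrow> nat \<Rightarrow> real" where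
  "bracket H u x k = Max (u ` hedge H k) + Min (u ` hedge H k) - 2 * u x"

lemma finite_hedge:
  assumes "is_hypergraph H" "k \<in> {1..num_edges H}"
  shows "finite (hedge H k)"
  using assms unfolding is_hypergraph_def by (meson finite_subset)

text \<open>With positive weights and a strictly increasing nonlinearity, the operator at \<open>x\<close> is strictly
  increasing in the family of brackets over the edges through \<open>x\<close>. An ordered pair of such
  families with equal operator values must therefore agree.\<close>

lemma hyper_L_eq_imp_bracket_eq:
  assumes "p > 1" "is_hypergraph H"
    and "hyper_L H p u x = hyper_L H p v x"
    and le: "\<And>k. k \<in> {1..num_edges H} \<Longrightarrow> x \<in> hedge H k \<Longrightarrow> bracket H u x k \<le> bracket H v x k"
    and k: "k \<in> {1..num_edges H}" "x \<in> hedge H k"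
  shows "bracket H u x k = bracket H v x k"
proof -
  define \<phi> :: "real \<Rightarrow> real" where "\<phi> t = \<bar>t\<bar> powr (p - 2) * t" for t
  define summand where "summand w j = weight H j * indicator (hedge H j) x * \<phi> (bracket H w x j)" for w j
  have mono: "strict_mono \<phi>"
    unfolding \<phi>_def using strict_mono_abs_powr_mult[OF \<open>p > 1\<close>] .
  have w: "weight H j > 0" if "j \<in> {1..num_edges H}" for j
    using that \<open>is_hypergraph H\<close> by (simp add: is_hypergraph_def)
  have L: "hyper_L H p w x = sum (summand w) {1..num_edges H}" for w
    by (simp add: hyper_L_def summand_def \<phi>_def bracket_def mult.assoc)
  have "summand u j \<le> summand v j" if "j \<in> {1..num_edges H}" for j
    using le[OF that] w[OF that] mono
    by (auto simp: summand_def indicator_def strict_mono_less_eq intro!: mult_left_mono)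
  then have "summand u k = summand v k"
    using sum_mono_inv[of "summand u" "{1..num_edges H}" "summand v" k] assms(3) k L by simp
  then have "\<phi> (bracket H u x k) = \<phi> (bracket H v x k)"
    using w[OF k(1)] k(2) by (simp add: summand_def)
  then show ?thesis
    using strict_mono_eq[OF mono] by blast
qed

text \<open>Comparison with the zero function, all of whose brackets vanish.\<close>

lemma bracket_eq_0_if_nonpos:
  assumes "p > 1" "is_hypergraph H" "hyper_L H p u x = 0"
    and "\<And>k. k \<in> {1..num_edges H} \<Longrightarrow> x \<in> hedge H k \<Longrightarrow> bracket H u x k \<le> 0"
    and k: "k \<in> {1..num_edges H}" "x \<in> hedge H k"
  shows "bracket H u x k = 0"
proof -
  have zero: "bracket H (\<lambda>_. 0) x j = 0" if "j \<in> {1..num_edges H}" for j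
    using that \<open>is_hypergraph H\<close> by (simp add: bracket_def is_hypergraph_def image_constant_conv)
  have "hyper_L H p u x = hyper_L H p (\<lambda>_. 0) x"
    unfolding assms(3) unfolding hyper_L_def
    using zero by (intro sum.neutral[symmetric]) (simp add: bracket_def)
  moreover have "bracket H u x j \<le> bracket H (\<lambda>_. 0) x j"
    if "j \<in> {1..num_edges H}" "x \<in> hedge H j" for j
    using assms(4)[OF that] zero[OF that(1)] by simp
  ultimately have "bracket H u x k = bracket H (\<lambda>_. 0) x k"
    using hyper_L_eq_imp_bracket_eq[OF assms(1,2) _ _ k] by blast
  then show ?thesis
    using zero[OF k(1)] by simp
qed

lemma Max_image_le_shift:
  fixes u v :: "'v \<Rightarrow> real"
  assumes "finite e" "e \<noteq> {}" "\<And>y. y \<in> e \<Longrightarrow> u y \<le> v y + M"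
  shows "Max (u ` e) \<le> Max (v ` e) + M"
proof -
  have "u y \<le> Max (v ` e) + M" if "y \<in> e" for y
  proof -
    have "v y \<le> Max (v ` e)" using that assms(1) by simp
    then show ?thesis using assms(3)[OF that] by linarith
  qed
  then show ?thesis using assms by simp
qed

lemma Min_image_le_shift:
  fixes u v :: "'v \<Rightarrow> real"
  assumes "finite e" "e \<noteq> {}" "\<And>y. y \<in> e \<Longrightarrow> u y \<le> v y + M"
  shows "Min (u ` e) \<le> Min (v ` e) + M"
proof -
  have "Min (u ` e) - M \<le> v y" if "y \<in> e" for y
  proof -
    have "Min (u ` e) \<le> u y" using that assms(1) by simp
    then show ?thesis using assms(3)[OF that] by linarith
  qed
  then have "Min (u ` e) - M \<le> Min (v ` e)" using assms by simp
  then show ?thesis by simp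
qed

text \<open>Where \<open>u\<close> touches \<open>v + M\<close> from below, the brackets of \<open>u\<close> and \<open>v\<close> are ordered and therefore
  equal. The bracket is the sum of two edge extrema, each ordered on its own, so both agree up to
  the shift \<open>M\<close>.\<close>

lemma edge_extrema_at_contact:
  fixes u v :: "'v \<Rightarrow> real"
  assumes "p > 1" and H: "is_hypergraph H"
    and "hyper_L H p u x = hyper_L H p v x"
    and le: "\<And>y. y \<in> verts H \<Longrightarrow> u y \<le> v y + M"
    and contact: "u x = v x + M"
    and k: "k \<in> {1..num_edges H}" "x \<in> hedge H k"
  shows "Max (u ` hedge H k) = Max (v ` hedge H k) + M"
    and "Min (u ` hedge H k) = Min (v ` hedge H k) + M"
proof -
  have shift: "Max (u ` hedge H j) \<le> Max (v ` hedge H j) + M"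
      "Min (u ` hedge H j) \<le> Min (v ` hedge H j) + M" if j: "j \<in> {1..num_edges H}" for j
  proof -
    have "hedge H j \<noteq> {}" "hedge H j \<subseteq> verts H"
      using H j by (auto simp: is_hypergraph_def)
    then show "Max (u ` hedge H j) \<le> Max (v ` hedge H j) + M"
      "Min (u ` hedge H j) \<le> Min (v ` hedge H j) + M"
      using finite_hedge[OF H j] le
      by (auto intro!: Max_image_le_shift Min_image_le_shift simp del: Max_le_iff Min_ge_iff)
  qed
  have "bracket H u x j \<le> bracket H v x j" if "j \<in> {1..num_edges H}" for j
    using shift[OF that] contact by (simp add: bracket_def)
  then have "bracket H u x k = bracket H v x k"
    using hyper_L_eq_imp_bracket_eq[OF assms(1-3) _ k] by blast
  then show "Max (u ` hedge H k) = Max (v ` hedge H k) + M"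
    and "Min (u ` hedge H k) = Min (v ` hedge H k) + M"
    using shift[OF k(1)] contact by (simp_all add: bracket_def)
qed

lemma connected_edge_closed_contains_verts:
  assumes "hypergraph_connected H"
    and "x \<in> verts H" "x \<in> S"
    and closed: "\<And>k. k \<in> {1..num_edges H} \<Longrightarrow> hedge H k \<inter> S \<noteq> {} \<Longrightarrow> hedge H k \<subseteq> S"
  shows "verts H \<subseteq> S"
proof
  fix y
  assume "y \<in> verts H"
  then obtain l :: nat and \<kappa> where "l \<ge> 1"
    and \<kappa>: "\<forall>s\<in>{1..l}. \<kappa> s \<in> {1..num_edges H}"
    and ends: "x \<in> hedge H (\<kappa> 1)" "y \<in> hedge H (\<kappa> l)"
    and chain: "\<forall>s\<in>{1..<l}. hedge H (\<kappa> s) \<inter> hedge H (\<kappa> (s + 1)) \<noteq> {}"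
    using assms(1,2) unfolding hypergraph_connected_def by meson
  have "s \<le> l \<Longrightarrow> hedge H (\<kappa> s) \<subseteq> S" if "s \<ge> 1" for s
    using that
  proof (induction s rule: dec_induct)
    case base
    then show ?case using \<kappa> ends \<open>x \<in> S\<close> by (intro closed) auto
  next
    case (step s)
    then have "hedge H (\<kappa> s) \<subseteq> S" "hedge H (\<kappa> s) \<inter> hedge H (\<kappa> (Suc s)) \<noteq> {}"
      using bspec[OF chain, of s] by auto
    then show ?case using \<kappa> step by (intro closed) auto
  qed
  then show "y \<in> S" using \<open>l \<ge> 1\<close> ends by blast
qed

text \<open>A contact vertex \<open>x\<close> at which \<open>u\<close> is largest among all contact vertices passes both properties
  on to its edges. A vertex \<open>y\<close> where \<open>u\<close> attains its edge maximum is itself a contact vertex,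
  because \<open>u y = Max v + M \<ge> v y + M\<close>, and hence \<open>u y \<le> u x\<close>. So every edge maximum is \<open>u x\<close>, the
  brackets of \<open>u\<close> are nonpositive, and the vanishing of the operator turns them into zeros.\<close>

lemma constant_on_edges_at_highest_contact:
  fixes u v :: "'v \<Rightarrow> real"
  assumes p: "p > 1" and H: "is_hypergraph H"
    and Lu: "hyper_L H p u x = 0" and Lv: "hyper_L H p v x = 0"
    and le: "\<And>y. y \<in> verts H \<Longrightarrow> u y \<le> v y + M"
    and contact: "u x = v x + M"
    and highest: "\<And>y. y \<in> verts H \<Longrightarrow> u y = v y + M \<Longrightarrow> u y \<le> u x"
    and k: "k \<in> {1..num_edges H}" "x \<in> hedge H k" and z: "z \<in> hedge H k"
  shows "u z = u x" "v z = v x"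
proof -
  have extrema: "Max (u ` hedge H j) = Max (v ` hedge H j) + M"
    "Min (u ` hedge H j) = Min (v ` hedge H j) + M"
    if "j \<in> {1..num_edges H}" "x \<in> hedge H j" for j
    using edge_extrema_at_contact[where u = u and v = v and M = M, OF p H _ le contact that] Lu Lv
    by simp_all
  have Max_u: "Max (u ` hedge H j) = u x"
    if j: "j \<in> {1..num_edges H}" "x \<in> hedge H j" for j
  proof -
    have fin: "finite (hedge H j)" by (rule finite_hedge[OF H j(1)])
    then have "Max (u ` hedge H j) \<in> u ` hedge H j" using j by (intro Max_in) auto
    then obtain y where y: "y \<in> hedge H j" "u y = Max (u ` hedge H j)" by force
    have "y \<in> verts H" using y H j by (auto simp: is_hypergraph_def)
    moreover have "v y \<le> Max (v ` hedge H j)" using fin y by simp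
    ultimately have "u y \<le> u x" using le[of y] highest[of y] extrema(1)[OF j] y by simp
    moreover have "u x \<le> Max (u ` hedge H j)" using fin j by simp
    ultimately show ?thesis using y by simp
  qed
  have fin: "finite (hedge H k)" by (rule finite_hedge[OF H k(1)])
  have "bracket H u x j \<le> 0" if j: "j \<in> {1..num_edges H}" "x \<in> hedge H j" for j
    using Max_u[OF j] Min_le[of "u ` hedge H j" "u x"] finite_hedge[OF H j(1)] j
    by (simp add: bracket_def)
  then have "bracket H u x k = 0"
    using bracket_eq_0_if_nonpos[OF p H Lu _ k] by blast
  then have Min_u: "Min (u ` hedge H k) = u x"
    using Max_u[OF k] by (simp add: bracket_def)
  have "Min (u ` hedge H k) \<le> u z" "u z \<le> Max (u ` hedge H k)"
    "Min (v ` hedge H k) \<le> v z" "v z \<le> Max (v ` hedge H k)"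
    using fin z by simp_all
  then show "u z = u x" "v z = v x"
    using Min_u Max_u[OF k] extrema[OF k] contact by linarith+
qed

theorem theorem2p6:
  fixes H :: "(real ^ 'd) hypergraph"
    and p :: real
    and L :: "(real ^ 'd) set"
    and u\<^sub>1 u\<^sub>2 :: "real ^ 'd \<Rightarrow> real"
  assumes "p > 1"
    and "is_hypergraph H"
    and "hypergraph_connected H"
    and "L \<subseteq> verts H" and "L \<noteq> {}"
    and "\<forall>x\<in>verts H - L. hyper_L H p u\<^sub>1 x = 0"
    and "\<forall>x\<in>verts H - L. hyper_L H p u\<^sub>2 x = 0"
    and "\<forall>x\<in>L. u\<^sub>1 x \<le> u\<^sub>2 x"
  shows "\<forall>x\<in>verts H. u\<^sub>1 x \<le> u\<^sub>2 x"
proof (rule ccontr)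
  assume "\<not> (\<forall>x\<in>verts H. u\<^sub>1 x \<le> u\<^sub>2 x)"
  then obtain x0 where x0: "x0 \<in> verts H" "u\<^sub>1 x0 > u\<^sub>2 x0" by force
  have fin: "finite (verts H)" using assms(2) by (simp add: is_hypergraph_def)
  define M where "M = Max ((\<lambda>x. u\<^sub>1 x - u\<^sub>2 x) ` verts H)"
  have diff_le: "u\<^sub>1 x - u\<^sub>2 x \<le> M" if "x \<in> verts H" for x
    unfolding M_def using fin that by simp
  then have le: "u\<^sub>1 x \<le> u\<^sub>2 x + M" if "x \<in> verts H" for x
    using that by force
  have "M > 0" using diff_le[OF x0(1)] x0(2) by linarith
  define A where "A = {x \<in> verts H. u\<^sub>1 x = u\<^sub>2 x + M}"
  have "M \<in> (\<lambda>x. u\<^sub>1 x - u\<^sub>2 x) ` verts H"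
    unfolding M_def using fin x0 by (intro Max_in) auto
  then have "A \<noteq> {}" by (auto simp: A_def)
  moreover have "finite A" using fin by (simp add: A_def)
  ultimately have "Max (u\<^sub>1 ` A) \<in> u\<^sub>1 ` A" by (intro Max_in) auto
  then obtain a where a: "a \<in> A" "u\<^sub>1 a = Max (u\<^sub>1 ` A)" by force
  have highest: "u\<^sub>1 y \<le> u\<^sub>1 a" if "y \<in> A" for y
    using \<open>finite A\<close> a that by simp
  have disjoint: "x \<notin> L" if "x \<in> A" for x
    using that \<open>M > 0\<close> assms(8) by (force simp: A_def)
  define S where "S = {x \<in> A. u\<^sub>1 x = u\<^sub>1 a}"
  have "hedge H k \<subseteq> S" if k: "k \<in> {1..num_edges H}" and "hedge H k \<inter> S \<noteq> {}" for k
  proof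
    fix z
    assume z: "z \<in> hedge H k"
    obtain x where x: "x \<in> hedge H k" "x \<in> S" using \<open>hedge H k \<inter> S \<noteq> {}\<close> by blast
    then have "x \<in> verts H - L" and contact: "u\<^sub>1 x = u\<^sub>2 x + M" and "u\<^sub>1 x = u\<^sub>1 a"
      using disjoint by (auto simp: S_def A_def)
    have Lx: "hyper_L H p u\<^sub>1 x = 0" "hyper_L H p u\<^sub>2 x = 0"
      using assms(6,7) \<open>x \<in> verts H - L\<close> by blast+
    have top: "u\<^sub>1 y \<le> u\<^sub>1 x" if "y \<in> verts H" "u\<^sub>1 y = u\<^sub>2 y + M" for y
      using highest[of y] that \<open>u\<^sub>1 x = u\<^sub>1 a\<close> by (simp add: A_def)
    have "u\<^sub>1 z = u\<^sub>1 x" "u\<^sub>2 z = u\<^sub>2 x"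
      using constant_on_edges_at_highest_contact
        [where u = u\<^sub>1 and v = u\<^sub>2 and M = M, OF assms(1,2) Lx le contact top k x(1) z]
      by blast+
    moreover have "z \<in> verts H" using z k assms(2) by (auto simp: is_hypergraph_def)
    ultimately show "z \<in> S"
      using contact \<open>u\<^sub>1 x = u\<^sub>1 a\<close> by (simp add: S_def A_def)
  qed
  then have "verts H \<subseteq> S"
    using a by (intro connected_edge_closed_contains_verts[OF assms(3), of a]) (auto simp: S_def A_def)
  then show False
    using assms(4,5) disjoint by (force simp: S_def)
qed

end
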